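(* Let $U$ and $V$ be Banach spaces with norms $\|\cdot\|_U$ and $\|\cdot\|_V$. For every $\varepsilon>0$ let $\bar u_\varepsilon\in U$ and $F_\varepsilon\in C^1(U;V)$ be given. Suppose that: (a) there exist $\varepsilon_0>0$ and $\rho>0$ such that for all $\varepsilon\in(0,\varepsilon_0]$ the operators $F_\varepsilon'(\bar u_\varepsilon)$ are Fredholm of index zero from $U$ into $V$, and $\|F_\varepsilon'(\bar u_\varepsilon)u\|_V\ge\rho\|u\|_U$ for all $u\in U$; (b) $\displaystyle\sup_{\|v\|_U\le1}\|(F_\varepsilon'(\bar u_\varepsilon+u)-F_\varepsilon'(\bar u_\varepsilon))v\|_V\to0$ for $\varepsilon+\|u\|_U\to0$; (c) $\|F_\varepsilon(\bar u_\varepsilon)\|_V\to0$ for $\varepsilon\to0$. Then there exist $\varepsilon_1\in(0,\varepsilon_0]$ and $\delta>0$ such that for all $\varepsilon\in(0,\varepsilon_1]$ there exists exactly one solution $u=u_\varepsilon$ to $F_\varepsilon(u)=0$ with $\|u-\bar u_\varepsilon\|_U\le\delta$. Moreover, for all $\varepsilon\in(0,\varepsilon_1]$ we have $$\|u_\varepsilon-\bar u_\varepsilon\|_U\le\frac{2}{\rho}\|F_\varepsilon(\bar u_\varepsilon)\|_V.$$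
   Context: $F_\varepsilon'(u)$ denotes the Fréchet derivative of $F_\varepsilon$ at $u$. The limit "for $\varepsilon+\|u\|_U\to0$" is taken over all $\varepsilon>0$ and $u\in U$ jointly: for each $\eta>0$ there is $\kappa>0$ such that the quantity is at most $\eta$ whenever $\varepsilon>0$, $u\in U$ and $\varepsilon+\|u\|_U\le\kappa$. *)

theory Defs
  imports "HOL-Analysis.Analysis"
begin

text \<open>
  The library has no quotient vector spaces, so the codimension of a subspace \<open>S\<close> of \<open>V\<close>, i.e. the
  dimension of \<open>V / S\<close>, is expressed through representatives: \<open>basis_modulo S B\<close> says that \<open>B\<close> is
  finite and that the cosets \<open>b + S\<close> (\<open>b \<in> B\<close>) are distinct and form a basis of \<open>V / S\<close>, i.e. every
  coset \<open>v + S\<close> has exactly one family of coordinates. The coordinate functions are made to vanish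
  outside \<open>B\<close> only to make them unique as functions.
\<close>

definition basis_modulo :: "'a::real_vector set \<Rightarrow> 'a set \<Rightarrow> bool" where
  "basis_modulo S B \<longleftrightarrow> finite B \<and>
     (\<forall>v. \<exists>!c :: 'a \<Rightarrow> real. (\<forall>b. b \<notin> B \<longrightarrow> c b = 0) \<and> v - (\<Sum>b\<in>B. c b *\<^sub>R b) \<in> S)"

definition finite_codim :: "'a::real_vector set \<Rightarrow> bool" where
  "finite_codim S \<longleftrightarrow> (\<exists>B. basis_modulo S B)"

text \<open>Only meaningful if \<open>S\<close> is a subspace with \<open>finite_codim S\<close>; see \<open>codim_eq_card\<close> below.\<close>

definition codim :: "'a::real_vector set \<Rightarrow> nat" where
  "codim S = (THE n. \<exists>B. basis_modulo S B \<and> card B = n)"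

definition kernel :: "('a::real_normed_vector \<Rightarrow>\<^sub>L 'b::real_normed_vector) \<Rightarrow> 'a set" where
  "kernel T = {x. blinfun_apply T x = 0}"

text \<open>
  Closedness of the range is not listed separately: between Banach spaces it follows from the finite
  codimension of the range. Finite-dimensionality of the kernel has to be stated explicitly because
  \<^const>\<open>dim\<close> is 0 on infinite-dimensional subspaces.
\<close>

definition fredholm :: "('a::banach \<Rightarrow>\<^sub>L 'b::banach) \<Rightarrow> bool" where
  "fredholm T \<longleftrightarrow> (\<exists>B. finite B \<and> kernel T = span B) \<and> finite_codim (range (blinfun_apply T))"

definition fredholm_index :: "('a::banach \<Rightarrow>\<^sub>L 'b::banach) \<Rightarrow> int" where
  "fredholm_index T = int (dim (kernel T)) - int (codim (range (blinfun_apply T)))"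

text \<open>\<open>F\<close> is continuously Frechet differentiable on the whole space, with derivative \<open>F'\<close>.\<close>

definition C1_with_derivative ::
  "('a::real_normed_vector \<Rightarrow> 'b::real_normed_vector) \<Rightarrow> ('a \<Rightarrow> 'a \<Rightarrow>\<^sub>L 'b) \<Rightarrow> bool" where
  "C1_with_derivative F F' \<longleftrightarrow>
     (\<forall>u. (F has_derivative blinfun_apply (F' u)) (at u)) \<and> continuous_on UNIV F'"

lemma basis_modulo_card_le:
  assumes S: "subspace S" and B: "basis_modulo S B" and C: "basis_modulo S C"
  shows "card B \<le> card C"
proof -
  have finB: "finite B" and finC: "finite C"
    using B C by (auto simp: basis_modulo_def)
  have "\<exists>y. y \<in> span C \<and> v - y \<in> S" for v
  proof -
    obtain c where "v - (\<Sum>b\<in>C. c b *\<^sub>R b) \<in> S"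
      using C unfolding basis_modulo_def by blast
    moreover have "(\<Sum>b\<in>C. c b *\<^sub>R b) \<in> span C"
      by (intro span_sum span_scale span_base)
    ultimately show ?thesis by blast
  qed
  then obtain f where f: "\<And>v. f v \<in> span C" "\<And>v. v - f v \<in> S" by metis
  have zero: "\<forall>b\<in>B. c b = 0" if "(\<Sum>b\<in>B. c b *\<^sub>R f b) = 0" for c
  proof -
    have "(\<Sum>b\<in>B. c b *\<^sub>R (b - f b)) \<in> S"
      by (intro subspace_sum[OF S] subspace_scale[OF S] f)
    then have "(\<Sum>b\<in>B. c b *\<^sub>R b) \<in> S"
      using that by (simp add: scaleR_diff_right sum_subtractf)
    then have "- (\<Sum>b\<in>B. c b *\<^sub>R b) \<in> S" by (rule subspace_neg[OF S])
    then have 1: "0 - (\<Sum>b\<in>B. (if b \<in> B then c b else 0) *\<^sub>R b) \<in> S" by simp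
    define P where "P = (\<lambda>c :: 'a \<Rightarrow> real. (\<forall>b. b \<notin> B \<longrightarrow> c b = 0) \<and> 0 - (\<Sum>b\<in>B. c b *\<^sub>R b) \<in> S)"
    have "\<exists>!c. P c"
      using B unfolding basis_modulo_def P_def by blast
    moreover have "P (\<lambda>b. if b \<in> B then c b else 0)"
      using 1 by (simp add: P_def)
    moreover have "P (\<lambda>b. 0)"
      using subspace_0[OF S] by (simp add: P_def)
    ultimately have eq: "(\<lambda>b. if b \<in> B then c b else 0) = (\<lambda>b. 0)"
      by blast
    show ?thesis using fun_cong[OF eq] by metis
  qed
  have inj: "inj_on f B"
  proof (rule inj_onI, rule ccontr)
    fix x y assume xy: "x \<in> B" "y \<in> B" "f x = f y" "x \<noteq> y"
    let ?c = "\<lambda>b. (if b = x then 1 else 0) - (if b = y then 1 else (0::real))"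
    have "(\<Sum>b\<in>B. ?c b *\<^sub>R f b) =
        (\<Sum>b\<in>B. if b = x then f b else 0) - (\<Sum>b\<in>B. if b = y then f b else 0)"
      unfolding sum_subtractf[symmetric] by (intro sum.cong) auto
    also have "\<dots> = 0" using xy finB by simp
    finally show False using zero[of ?c] xy by auto
  qed
  have "independent (f ` B)"
  proof (rule independent_if_scalars_zero)
    fix g x assume g: "(\<Sum>x\<in>f ` B. g x *\<^sub>R x) = 0" and x: "x \<in> f ` B"
    show "g x = 0"
      using zero[of "g \<circ> f"] g x by (auto simp: sum.reindex[OF inj])
  qed (use finB in simp)
  then have "card (f ` B) \<le> card C"
    using independent_span_bound[OF finC, of "f ` B"] f by auto
  then show ?thesis by (simp add: card_image[OF inj])
qed

lemma codim_eq_card: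
  assumes "subspace S" "basis_modulo S B"
  shows "codim S = card B"
  unfolding codim_def
  by (rule the_equality)
     (use assms basis_modulo_card_le[OF assms(1)] in \<open>auto intro: antisym\<close>)

end

theory Submission
  imports Defs
begin

text \<open>
  The theorem is a quantitative inverse function theorem, applied to each \<open>F \<epsilon>\<close> with constants that
  do not depend on \<open>\<epsilon>\<close>. A Fredholm operator of index zero that is bounded below by \<open>\<rho>\<close> has trivial
  kernel, hence a range of codimension zero, hence is bijective (\<open>fredholm_index_0_bij\<close>), and its
  inverse has norm at most \<open>1/\<rho>\<close>. So \<open>F \<epsilon> u = 0\<close> can be rewritten as the fixed point equation of the
  simplified Newton map \<open>u \<mapsto> u - T\<inverse> (F \<epsilon> u)\<close>, where \<open>T = F' \<epsilon> (ubar \<epsilon>)\<close>.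

  By (b) there is a radius \<open>\<delta>\<close>, the same for all small \<open>\<epsilon>\<close>, such that \<open>F' \<epsilon>\<close> stays within \<open>\<rho>/2\<close> of
  \<open>T\<close> on the ball of radius \<open>\<delta>\<close> around \<open>ubar \<epsilon>\<close>. By the mean value inequality \<open>F \<epsilon> - T\<close> is then
  \<open>\<rho>/2\<close>-Lipschitz on this ball. Two things follow: \<open>F \<epsilon>\<close> still expands distances by at least \<open>\<rho>/2\<close>
  there, which gives uniqueness and, by comparing a zero with the centre \<open>ubar \<epsilon>\<close>, the error
  estimate with the constant \<open>2/\<rho>\<close> (\<open>expanding_of_derivative_close\<close>); and the Newton map contracts with factor \<open>1/2\<close>. By (c) the
  residual at the centre is eventually at most \<open>\<rho> * \<delta> / 2\<close>, so that the Newton map moves the centre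
  by at most \<open>\<delta>/2\<close> and maps the ball into itself. Banach's fixed point theorem gives existence
  (\<open>newton_zero_in_ball\<close>).
\<close>

text \<open>
  A basis modulo \<open>S\<close> with no elements expands every \<open>v\<close> as an empty sum, so \<open>v - 0 \<in> S\<close>.
\<close>

lemma codim_0_eq_UNIV:
  assumes S: "subspace S" and fin: "finite_codim S" and 0: "codim S = 0"
  shows "S = UNIV"
proof -
  obtain B where B: "basis_modulo S B"
    using fin unfolding finite_codim_def by blast
  then have "B = {}"
    using codim_eq_card[OF S B] 0 by (auto simp: basis_modulo_def)
  then have "v \<in> S" for v
    using B unfolding basis_modulo_def by auto
  then show ?thesis by blast
qed

lemma fredholm_index_0_bij:
  fixes T :: "'a::banach \<Rightarrow>\<^sub>L 'b::banach"
  assumes "fredholm T" "fredholm_index T = 0" "0 < \<rho>"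
    and bound: "\<And>u. \<rho> * norm u \<le> norm (blinfun_apply T u)"
  shows "bij (blinfun_apply T)"
proof -
  have ker: "u = 0" if "blinfun_apply T u = 0" for u
    using bound[of u] that \<open>0 < \<rho>\<close> by (simp add: mult_le_0_iff)
  then have "kernel T = {0}"
    by (auto simp: kernel_def blinfun.zero_right)
  then have "codim (range (blinfun_apply T)) = 0"
    using assms(2) dim_span[of "{} :: 'a set"] dim_eq_card_independent[OF independent_empty]
    by (simp add: fredholm_index_def)
  moreover have "subspace (range (blinfun_apply T))"
    using linear_subspace_image[OF bounded_linear.linear[OF blinfun.bounded_linear_right] subspace_UNIV] .
  ultimately have "range (blinfun_apply T) = UNIV"
    using codim_0_eq_UNIV assms(1) by (auto simp: fredholm_def)
  moreover have "inj (blinfun_apply T)"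
    by (rule injI) (use ker in \<open>metis blinfun.diff_right right_minus_eq\<close>)
  ultimately show ?thesis by (simp add: bij_def)
qed

text \<open>
  Hypothesis (b) of the theorem measures operators by a supremum over the unit ball. That supremum
  dominates the operator norm because every vector can be scaled to the unit sphere; boundedness
  of the operator makes the supremum a genuine upper bound.
\<close>

lemma norm_blinfun_le_of_SUP_unit_ball:
  fixes D :: "'a::real_normed_vector \<Rightarrow>\<^sub>L 'b::real_normed_vector"
  assumes sup: "(SUP v\<in>{v. norm v \<le> 1}. norm (blinfun_apply D v)) \<le> \<eta>" and "0 \<le> \<eta>"
  shows "norm D \<le> \<eta>"
proof (rule norm_blinfun_bound[OF \<open>0 \<le> \<eta>\<close>])
  fix x
  have bdd: "bdd_above ((\<lambda>v. norm (blinfun_apply D v)) ` {v. norm v \<le> 1})"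
  proof (rule bdd_aboveI2)
    fix v :: 'a assume "v \<in> {v. norm v \<le> 1}"
    then show "norm (blinfun_apply D v) \<le> norm D"
      using norm_blinfun[of D v] mult_left_le[of "norm v" "norm D"] by simp
  qed
  show "norm (blinfun_apply D x) \<le> \<eta> * norm x"
  proof (cases "x = 0")
    case False
    have "norm (blinfun_apply D (x /\<^sub>R norm x)) \<le> \<eta>"
      using cSUP_upper[OF _ bdd, of "x /\<^sub>R norm x"] sup False by simp
    then show ?thesis
      using False by (simp add: blinfun.scaleR_right field_simps)
  qed (simp add: blinfun.zero_right)
qed

text \<open>
  The Lipschitz constant \<open>\<rho>/2\<close> of \<open>G - T\<close> is half of the lower bound \<open>\<rho>\<close> of \<open>T\<close>, so \<open>G\<close> keeps the
  other half of the expansion.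
\<close>

lemma expanding_of_derivative_close:
  fixes G :: "'a::real_normed_vector \<Rightarrow> 'b::real_normed_vector" and T :: "'a \<Rightarrow>\<^sub>L 'b"
  assumes deriv: "\<And>u. u \<in> S \<Longrightarrow> (G has_derivative blinfun_apply (G' u)) (at u within S)"
    and "convex S"
    and bound: "\<And>u. \<rho> * norm u \<le> norm (blinfun_apply T u)"
    and close: "\<And>u. u \<in> S \<Longrightarrow> norm (G' u - T) \<le> \<rho> / 2"
    and x: "x \<in> S" and y: "y \<in> S"
  shows "norm ((G x - blinfun_apply T x) - (G y - blinfun_apply T y)) \<le> \<rho> / 2 * norm (x - y)"
    and "\<rho> / 2 * norm (x - y) \<le> norm (G x - G y)"
proof -
  show lip: "norm ((G x - blinfun_apply T x) - (G y - blinfun_apply T y)) \<le> \<rho> / 2 * norm (x - y)"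
  proof (rule differentiable_bound[OF \<open>convex S\<close>])
    fix u assume "u \<in> S"
    have "((\<lambda>u. G u - blinfun_apply T u) has_derivative
        (\<lambda>v. blinfun_apply (G' u) v - blinfun_apply T v)) (at u within S)"
      by (intro has_derivative_diff deriv \<open>u \<in> S\<close> bounded_linear_imp_has_derivative
          blinfun.bounded_linear_right)
    then show "((\<lambda>u. G u - blinfun_apply T u) has_derivative blinfun_apply (G' u - T))
        (at u within S)"
      by (simp add: blinfun.diff_left[abs_def])
    show "onorm (blinfun_apply (G' u - T)) \<le> \<rho> / 2"
      using close[OF \<open>u \<in> S\<close>] by (simp add: norm_blinfun.rep_eq)
  qed (fact x y)+
  have "blinfun_apply T (x - y) =
      (G x - G y) - ((G x - blinfun_apply T x) - (G y - blinfun_apply T y))"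
    by (simp add: blinfun.diff_right)
  then have "norm (blinfun_apply T (x - y)) \<le> norm (G x - G y) + \<rho> / 2 * norm (x - y)"
    using lip norm_triangle_ineq4 by (metis add_left_mono order_trans)
  then show "\<rho> / 2 * norm (x - y) \<le> norm (G x - G y)"
    using bound[of "x - y"] by simp
qed

text \<open>
  The Newton map \<open>u \<mapsto> u - T\<inverse> (G u)\<close> equals \<open>u \<mapsto> - T\<inverse> (G u - T u)\<close>, which is why only the Lipschitz
  constant of \<open>G - T\<close> and the lower bound of \<open>T\<close> enter.
\<close>

lemma newton_zero_in_ball:
  fixes G :: "'a::banach \<Rightarrow> 'b::real_normed_vector" and T :: "'a \<Rightarrow>\<^sub>L 'b"
  assumes deriv: "\<And>u. u \<in> cball a \<delta> \<Longrightarrow>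
      (G has_derivative blinfun_apply (G' u)) (at u within cball a \<delta>)"
    and "0 < \<rho>" "0 \<le> \<delta>" "surj (blinfun_apply T)"
    and bound: "\<And>u. \<rho> * norm u \<le> norm (blinfun_apply T u)"
    and close: "\<And>u. u \<in> cball a \<delta> \<Longrightarrow> norm (G' u - T) \<le> \<rho> / 2"
    and small: "norm (G a) \<le> \<rho> * \<delta> / 2"
  shows "\<exists>u\<in>cball a \<delta>. G u = 0"
proof -
  obtain A where A: "\<And>v. blinfun_apply T (A v) = v"
    using \<open>surj (blinfun_apply T)\<close> by (metis surjD)
  define \<Phi> where "\<Phi> u = u - A (G u)" for u
  have T\<Phi>: "blinfun_apply T (\<Phi> u) = - (G u - blinfun_apply T u)" for u
    by (simp add: \<Phi>_def blinfun.diff_right A)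
  have contr: "dist (\<Phi> x) (\<Phi> y) \<le> 1 / 2 * dist x y" if "x \<in> cball a \<delta>" "y \<in> cball a \<delta>" for x y
  proof -
    have "\<rho> * norm (\<Phi> x - \<Phi> y) \<le> norm (blinfun_apply T (\<Phi> x - \<Phi> y))"
      by (rule bound)
    also have "blinfun_apply T (\<Phi> x - \<Phi> y) =
        - ((G x - blinfun_apply T x) - (G y - blinfun_apply T y))"
      by (simp add: blinfun.diff_right[of T "\<Phi> x"] T\<Phi>)
    also have "norm \<dots> = norm ((G x - blinfun_apply T x) - (G y - blinfun_apply T y))"
      by (rule norm_minus_cancel)
    also have "\<dots> \<le> \<rho> / 2 * norm (x - y)"
      by (rule expanding_of_derivative_close(1)[OF deriv convex_cball bound close that])
    finally show ?thesis
      using \<open>0 < \<rho>\<close> by (simp add: dist_norm)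
  qed
  have a: "a \<in> cball a \<delta>" using \<open>0 \<le> \<delta>\<close> by simp
  have "\<rho> * norm (A (G a)) \<le> \<rho> * (\<delta> / 2)"
    using bound[of "A (G a)"] small by (simp add: A)
  then have centre: "dist a (\<Phi> a) \<le> \<delta> / 2"
    using \<open>0 < \<rho>\<close> by (simp add: \<Phi>_def dist_norm)
  have self: "\<Phi> ` cball a \<delta> \<subseteq> cball a \<delta>"
  proof
    fix w assume "w \<in> \<Phi> ` cball a \<delta>"
    then obtain u where u: "u \<in> cball a \<delta>" "w = \<Phi> u" by blast
    have "dist a w \<le> dist a (\<Phi> a) + dist (\<Phi> a) (\<Phi> u)"
      using u by (simp add: dist_triangle)
    also have "\<dots> \<le> \<delta> / 2 + \<delta> / 2"
      using centre contr[OF a u(1)] u(1) by (intro add_mono) auto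
    finally show "w \<in> cball a \<delta>" by simp
  qed
  have "\<exists>!u\<in>cball a \<delta>. \<Phi> u = u"
    by (rule Banach_fix[where c = "1 / 2"])
       (use a self contr in \<open>auto simp: complete_eq_closed\<close>)
  then obtain u where u: "u \<in> cball a \<delta>" "\<Phi> u = u" by blast
  then have "A (G u) = 0" by (simp add: \<Phi>_def)
  then have "G u = 0" using A[of "G u"] by (simp add: blinfun.zero_right)
  with u show ?thesis by blast
qed

theorem theorem2p1:
  fixes ubar :: "real \<Rightarrow> 'u::banach"
    and F :: "real \<Rightarrow> 'u \<Rightarrow> 'v::banach"
    and F' :: "real \<Rightarrow> 'u \<Rightarrow> 'u \<Rightarrow>\<^sub>L 'v"
    and \<epsilon>\<^sub>0 \<rho> :: real
  assumes C1: "\<And>\<epsilon>. 0 < \<epsilon> \<Longrightarrow> C1_with_derivative (F \<epsilon>) (F' \<epsilon>)"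
    and pos: "0 < \<epsilon>\<^sub>0" "0 < \<rho>"
    and a_fredholm: "\<And>\<epsilon>. \<epsilon> \<in> {0<..\<epsilon>\<^sub>0} \<Longrightarrow>
      fredholm (F' \<epsilon> (ubar \<epsilon>)) \<and> fredholm_index (F' \<epsilon> (ubar \<epsilon>)) = 0"
    and a_bound: "\<And>\<epsilon> u. \<epsilon> \<in> {0<..\<epsilon>\<^sub>0} \<Longrightarrow>
      norm (blinfun_apply (F' \<epsilon> (ubar \<epsilon>)) u) \<ge> \<rho> * norm u"
    and b: "\<And>\<eta>. 0 < \<eta> \<Longrightarrow> \<exists>\<kappa>>0. \<forall>\<epsilon>>0. \<forall>u. \<epsilon> + norm u \<le> \<kappa> \<longrightarrow>
      (SUP v\<in>{v. norm v \<le> 1}.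
         norm (blinfun_apply (F' \<epsilon> (ubar \<epsilon> + u) - F' \<epsilon> (ubar \<epsilon>)) v)) \<le> \<eta>"
    and c: "((\<lambda>\<epsilon>. norm (F \<epsilon> (ubar \<epsilon>))) \<longlongrightarrow> 0) (at_right 0)"
  shows "\<exists>\<epsilon>\<^sub>1\<in>{0<..\<epsilon>\<^sub>0}. \<exists>\<delta>>0. \<forall>\<epsilon>\<in>{0<..\<epsilon>\<^sub>1}.
      (\<exists>!u. F \<epsilon> u = 0 \<and> norm (u - ubar \<epsilon>) \<le> \<delta>) \<and>
      (\<forall>u. F \<epsilon> u = 0 \<and> norm (u - ubar \<epsilon>) \<le> \<delta> \<longrightarrow>
        norm (u - ubar \<epsilon>) \<le> 2 / \<rho> * norm (F \<epsilon> (ubar \<epsilon>)))"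
proof -
  obtain \<kappa> where "0 < \<kappa>" and \<kappa>: "\<And>\<epsilon> u. 0 < \<epsilon> \<Longrightarrow> \<epsilon> + norm u \<le> \<kappa> \<Longrightarrow>
      (SUP v\<in>{v. norm v \<le> 1}.
         norm (blinfun_apply (F' \<epsilon> (ubar \<epsilon> + u) - F' \<epsilon> (ubar \<epsilon>)) v)) \<le> \<rho> / 2"
    using b[of "\<rho> / 2"] pos by auto
  \<comment> \<open>The joint budget \<open>\<kappa>\<close> for \<open>\<epsilon> + norm u\<close> is split evenly between \<open>\<epsilon>\<close> and the radius.\<close>
  define \<delta> where "\<delta> = \<kappa> / 2"
  have "0 < \<delta>" using \<open>0 < \<kappa>\<close> by (simp add: \<delta>_def)
  have "\<forall>\<^sub>F \<epsilon> in at_right 0. norm (F \<epsilon> (ubar \<epsilon>)) < \<rho> * \<delta> / 2"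
    using pos \<open>0 < \<delta>\<close> by (intro order_tendstoD(2)[OF c]) simp
  then obtain r where "0 < r" and r: "\<And>\<epsilon>. 0 < \<epsilon> \<Longrightarrow> \<epsilon> < r \<Longrightarrow> norm (F \<epsilon> (ubar \<epsilon>)) < \<rho> * \<delta> / 2"
    unfolding eventually_at_right_field by auto
  define \<epsilon>\<^sub>1 where "\<epsilon>\<^sub>1 = Min {\<epsilon>\<^sub>0, \<kappa> / 2, r / 2}"
  have \<epsilon>\<^sub>1: "0 < \<epsilon>\<^sub>1" "\<epsilon>\<^sub>1 \<le> \<epsilon>\<^sub>0" "\<epsilon>\<^sub>1 \<le> \<kappa> / 2" "\<epsilon>\<^sub>1 < r"
    using pos \<open>0 < \<kappa>\<close> \<open>0 < r\<close> by (auto simp: \<epsilon>\<^sub>1_def min_def)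
  have "(\<exists>!u. F \<epsilon> u = 0 \<and> norm (u - ubar \<epsilon>) \<le> \<delta>) \<and>
      (\<forall>u. F \<epsilon> u = 0 \<and> norm (u - ubar \<epsilon>) \<le> \<delta> \<longrightarrow>
        norm (u - ubar \<epsilon>) \<le> 2 / \<rho> * norm (F \<epsilon> (ubar \<epsilon>)))"
    if "\<epsilon> \<in> {0<..\<epsilon>\<^sub>1}" for \<epsilon>
  proof -
    let ?S = "cball (ubar \<epsilon>) \<delta>" and ?T = "F' \<epsilon> (ubar \<epsilon>)"
    have \<epsilon>: "0 < \<epsilon>" "\<epsilon> \<in> {0<..\<epsilon>\<^sub>0}" "\<epsilon> \<le> \<kappa> / 2" "\<epsilon> < r"
      using that \<epsilon>\<^sub>1 by auto
    have S: "u \<in> ?S \<longleftrightarrow> norm (u - ubar \<epsilon>) \<le> \<delta>" for u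
      by (simp add: dist_norm norm_minus_commute)
    have bound: "\<rho> * norm u \<le> norm (blinfun_apply ?T u)" for u
      using a_bound[OF \<epsilon>(2)] .
    have deriv: "(F \<epsilon> has_derivative blinfun_apply (F' \<epsilon> u)) (at u within ?S)" for u
      using C1[OF \<epsilon>(1)] unfolding C1_with_derivative_def by (blast intro: has_derivative_at_withinI)
    have close: "norm (F' \<epsilon> u - ?T) \<le> \<rho> / 2" if "u \<in> ?S" for u
      using \<kappa>[OF \<epsilon>(1), of "u - ubar \<epsilon>"] that[unfolded S] \<epsilon>(3) pos \<delta>_def
      by (intro norm_blinfun_le_of_SUP_unit_ball) auto
    have expand: "\<rho> / 2 * norm (x - y) \<le> norm (F \<epsilon> x - F \<epsilon> y)" if "x \<in> ?S" "y \<in> ?S" for x y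
      by (rule expanding_of_derivative_close(2)[OF deriv convex_cball bound close that])
    have "bij (blinfun_apply ?T)"
      using fredholm_index_0_bij a_fredholm[OF \<epsilon>(2)] pos(2) bound by blast
    then have "\<exists>u\<in>?S. F \<epsilon> u = 0"
      using newton_zero_in_ball[OF deriv pos(2) _ _ bound close] r[OF \<epsilon>(1,4)] \<open>0 < \<delta>\<close>
      by (simp add: bij_is_surj)
    moreover have "x = y" if "x \<in> ?S" "y \<in> ?S" "F \<epsilon> x = 0" "F \<epsilon> y = 0" for x y
      using expand[OF that(1,2)] that(3,4) pos(2) by (simp add: mult_le_0_iff)
    moreover have "norm (u - ubar \<epsilon>) \<le> 2 / \<rho> * norm (F \<epsilon> (ubar \<epsilon>))" if "u \<in> ?S" "F \<epsilon> u = 0" for u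
      using expand[OF that(1), of "ubar \<epsilon>"] that(2) pos(2) \<open>0 < \<delta>\<close> by (simp add: field_simps)
    ultimately show ?thesis
      unfolding Bex_def S by blast
  qed
  then show ?thesis
    using \<epsilon>\<^sub>1 \<open>0 < \<delta>\<close> by (intro bexI[of _ \<epsilon>\<^sub>1] exI[of _ \<delta>]) auto
qed

end
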